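(* Let $F,f:\mathbb{R}^n\times\mathbb{R}^m\to\mathbb{R}$, $G=(G_1,\dots,G_p):\mathbb{R}^n\times\mathbb{R}^m\to\mathbb{R}^p$, $g=(g_1,\dots,g_q):\mathbb{R}^n\times\mathbb{R}^m\to\mathbb{R}^q$. Let $(\bar x,\bar y)$ be a local minimizer of the bilevel problem $$\min_{x,y}F(x,y)\quad\text{s.t.}\quad y\in S(x),\ G(x,y)\le 0,$$ where $S(x)$ is the solution set of the lower-level problem $\min_y f(x,y)$ s.t. $g(x,y)\le 0$. Let $V(x):=\inf_y\{f(x,y):g(x,y)\le 0\}$, $H(x,y):=f(x,y)-V(x)$, let $\Xi$ be the set of $(x,y)$ with $H(x,y)\le 0$, $g_i(x,y)\le 0$ ($i=1,\dots,q$), $G_j(x,y)\le 0$ ($j=1,\dots,p$), and let $\mathcal{X}=\mathbb{R}^n\times\mathbb{R}^m$. Assume that: (i) the contingent tangent cone $T_\Xi(\bar x,\bar y)$ is convex, $F,H,g_i,G_j$ are locally Lipschitz and tangentially convex in a neighbourhood of $(\bar x,\bar y)$, and $V$ is locally Lipschitz and tangentially convex around $\bar x$; (ii) $F,H,g_i,G_j$ are Clarke regular at $(\bar x,\bar y)$; (iii) the normal cone mapping $z\mapsto N_{\mathcal{X}}(z)$ is outer semicontinuous at $(\bar x,\bar y)$; (iv) $(\bar x,\bar y)$ is bilevel T-quasinormal. Then the value-function reformulation $$\min_{x,y}F(x,y)\quad\text{s.t.}\quad H(x,y)\le 0,\ g_i(x,y)\le 0\ (i=1,\dots,q),\ G_j(x,y)\le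 0\ (j=1,\dots,p)$$ satisfies the enhanced T-KKT condition at $(\bar x,\bar y)$: there exist multipliers $\lambda,\alpha_1,\dots,\alpha_q,\beta_1,\dots,\beta_p\ge 0$ and vectors $\xi_F\in\partial_TF(\bar x,\bar y)$, $\xi_H\in\partial_TH(\bar x,\bar y)$, $\xi_i\in\partial_Tg_i(\bar x,\bar y)$, $\zeta_j\in\partial_TG_j(\bar x,\bar y)$, $\eta\in N_{\mathcal{X}}(\bar x,\bar y)=\{0\}$ such that $$0=\xi_F+\lambda\xi_H+\sum_{i=1}^q\alpha_i\xi_i+\sum_{j=1}^p\beta_j\zeta_j+\eta,$$ $$\lambda H(\bar x,\bar y)=0,\quad \alpha_ig_i(\bar x,\bar y)=0\ (i=1,\dots,q),\quad \beta_jG_j(\bar x,\bar y)=0\ (j=1,\dots,p).$$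
   Context: For a function $h$ on a Euclidean space with values in $\mathbb{R}\cup\{+\infty\}$ and $\bar z\in\operatorname{dom}h$, the directional derivative is $h'(\bar z;v):=\lim_{t\downarrow 0}\frac{h(\bar z+tv)-h(\bar z)}{t}$ whenever the limit exists. $h$ is tangentially convex at $\bar z$ if $h'(\bar z;v)$ exists and is finite for every direction $v$ and $v\mapsto h'(\bar z;v)$ is convex; "around $\bar z$" means at every point of a neighbourhood of $\bar z$. The tangential subdifferential is $\partial_T h(\bar z):=\{\xi:\langle\xi,v\rangle\le h'(\bar z;v)\ \forall v\}$. Local Lipschitz continuity around a point includes finiteness near that point. A locally Lipschitz $h$ is Clarke regular at $\bar z$ if $h'(\bar z;v)$ exists and equals the Clarke directional derivative $h^\circ(\bar z;v)$ for all $v$. For nonempty $S$ and $\bar z\in S$, the contingent tangent cone is $T_S(\bar z):=\{d:\exists t_k\downarrow 0,\ d_k\to d\text{ with }\bar z+t_kd_k\in S\}$; $N_S$ denotes the limiting normal cone. A multifunction $M$ is outer semicontinuous at $\bar z$ if $z^k\to\bar z$, $\xi^k\in M(z^k)$, $\xi^k\to\xi$ imply $\xi\in M(\bar z)$. Vector inequalities are componentwise. A local minimizer of the bilevel problem is a feasible $(\bar x,\bar y)$ (i.e. $\bar y\in S(\bar x)$, $G(\bar x,\bar y)\le 0$) with $F(\bar x,\bar y)\le F(x,y)$ for all feasible $(x,y)$ in some neighbourhood. A point $\bar z=(\bar x,\bar y)\in\Xi$ is bilevel T-quasinormal if there is no nonzero multiplier vector $(\lambda,\alpha,\beta)\in\mathbb{R}_+\times\mathbb{R}_+^q\times\mathbb{R}_+^p$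 such that $$0\in\lambda\,\partial_TH(\bar z)+\sum_{i=1}^q\alpha_i\,\partial_Tg_i(\bar z)+\sum_{j=1}^p\beta_j\,\partial_TG_j(\bar z)+N_{\mathcal{X}}(\bar z)$$ and there exists a sequence of infeasible points $z^k\to\bar z$ ($z^k\notin\Xi$) such that, for all $k$: $\lambda H(z^k)>0$ if $\lambda>0$; $\alpha_ig_i(z^k)>0$ for every $i$ with $\alpha_i>0$; $\beta_jG_j(z^k)>0$ for every $j$ with $\beta_j>0$. *)

theory Defs
  imports "HOL-Analysis.Analysis"
begin

text \<open>
  Functions take values in the extended reals, since a value function may be infinite; real-valued
  functions enter through the coercion \<^const>\<open>ereal\<close>.
\<close>

definition diff_quot :: "('a::euclidean_space \<Rightarrow> ereal) \<Rightarrow> 'a \<Rightarrow> 'a \<Rightarrow> real \<Rightarrow> ereal" where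
  "diff_quot h z v t = (h (z + t *\<^sub>R v) - h z) / ereal t"

definition dir_deriv :: "('a::euclidean_space \<Rightarrow> ereal) \<Rightarrow> 'a \<Rightarrow> 'a \<Rightarrow> ereal" where
  "dir_deriv h z v = Lim (at_right 0) (diff_quot h z v)"

definition tangentially_convex_at :: "('a::euclidean_space \<Rightarrow> ereal) \<Rightarrow> 'a \<Rightarrow> bool" where
  "tangentially_convex_at h z \<longleftrightarrow>
     \<bar>h z\<bar> \<noteq> \<infinity> \<and>
     (\<forall>v. \<exists>l::real. (diff_quot h z v \<longlongrightarrow> ereal l) (at_right 0)) \<and>
     convex_on UNIV (\<lambda>v. real_of_ereal (dir_deriv h z v))"

definition tangentially_convex_around :: "('a::euclidean_space \<Rightarrow> ereal) \<Rightarrow> 'a \<Rightarrow> bool" where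
  "tangentially_convex_around h z \<longleftrightarrow> (\<forall>\<^sub>F u in nhds z. tangentially_convex_at h u)"

text \<open>Only meaningful where the directional derivatives exist, as \<^const>\<open>Lim\<close> is total.\<close>

definition tangential_subdiff :: "('a::euclidean_space \<Rightarrow> ereal) \<Rightarrow> 'a \<Rightarrow> 'a set" where
  "tangential_subdiff h z = {\<xi>. \<forall>v. ereal (\<xi> \<bullet> v) \<le> dir_deriv h z v}"

definition locally_lipschitz_around :: "('a::euclidean_space \<Rightarrow> ereal) \<Rightarrow> 'a \<Rightarrow> bool" where
  "locally_lipschitz_around h z \<longleftrightarrow>
     (\<exists>r>0. (\<forall>u\<in>ball z r. \<bar>h u\<bar> \<noteq> \<infinity>) \<and>
            (\<exists>L. L-lipschitz_on (ball z r) (\<lambda>u. real_of_ereal (h u))))"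

definition clarke_dir_deriv :: "('a::euclidean_space \<Rightarrow> ereal) \<Rightarrow> 'a \<Rightarrow> 'a \<Rightarrow> ereal" where
  "clarke_dir_deriv h z v =
     Limsup (nhds z \<times>\<^sub>F at_right 0) (\<lambda>(u, t). diff_quot h u v t)"

definition clarke_regular :: "('a::euclidean_space \<Rightarrow> ereal) \<Rightarrow> 'a \<Rightarrow> bool" where
  "clarke_regular h z \<longleftrightarrow>
     locally_lipschitz_around h z \<and>
     (\<forall>v. (diff_quot h z v \<longlongrightarrow> clarke_dir_deriv h z v) (at_right 0))"


text \<open>Here \<open>t\<^sub>k \<down> 0\<close> is read as \<open>t\<^sub>k > 0\<close>, \<open>t\<^sub>k \<rightarrow> 0\<close>, without monotonicity.\<close>

definition contingent_cone :: "'a::euclidean_space set \<Rightarrow> 'a \<Rightarrow> 'a set" where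
  "contingent_cone S z =
     {d. \<exists>(t::nat \<Rightarrow> real) (e::nat \<Rightarrow> 'a).
           (\<forall>k. t k > 0) \<and> t \<longlonglongrightarrow> 0 \<and> e \<longlonglongrightarrow> d \<and> (\<forall>k. z + t k *\<^sub>R e k \<in> S)}"

definition frechet_normal_cone :: "'a::euclidean_space set \<Rightarrow> 'a \<Rightarrow> 'a set" where
  "frechet_normal_cone S z =
     (if z \<in> S
      then {\<xi>. \<forall>\<epsilon>>0. \<forall>\<^sub>F u in at z within S. \<xi> \<bullet> (u - z) \<le> \<epsilon> * norm (u - z)}
      else {})"

definition limiting_normal_cone :: "'a::euclidean_space set \<Rightarrow> 'a \<Rightarrow> 'a set" where
  "limiting_normal_cone S z =
     {\<xi>. z \<in> S \<and> (\<exists>(w::nat \<Rightarrow> 'a) \<zeta>. w \<longlonglongrightarrow> z \<and> \<zeta> \<longlonglongrightarrow> \<xi> \<and>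
           (\<forall>k. w k \<in> S \<and> \<zeta> k \<in> frechet_normal_cone S (w k)))}"

definition outer_semicontinuous_at ::
    "('a::euclidean_space \<Rightarrow> 'b::euclidean_space set) \<Rightarrow> 'a \<Rightarrow> bool" where
  "outer_semicontinuous_at M z \<longleftrightarrow>
     (\<forall>(w::nat \<Rightarrow> 'a) \<zeta> \<xi>.
        w \<longlonglongrightarrow> z \<longrightarrow> (\<forall>k. \<zeta> k \<in> M (w k)) \<longrightarrow> \<zeta> \<longlonglongrightarrow> \<xi> \<longrightarrow> \<xi> \<in> M z)"


text \<open>
  The constraint maps are given by their component functions \<open>g\<^sub>1, \<dots>, g\<^sub>q\<close> and \<open>G\<^sub>1, \<dots>, G\<^sub>p\<close>, as
  families indexed by natural numbers of which only the indices in \<open>{1..q}\<close> resp. \<open>{1..p}\<close> are used.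
\<close>

definition lower_feasible ::
    "(nat \<Rightarrow> 'a \<times> 'b \<Rightarrow> real) \<Rightarrow> nat \<Rightarrow> 'a \<Rightarrow> 'b set" where
  "lower_feasible g q x = {y. \<forall>i\<in>{1..q}. g i (x, y) \<le> 0}"

definition lower_solutions ::
    "('a \<times> 'b \<Rightarrow> real) \<Rightarrow> (nat \<Rightarrow> 'a \<times> 'b \<Rightarrow> real) \<Rightarrow> nat \<Rightarrow> 'a \<Rightarrow> 'b set" where
  "lower_solutions f g q x =
     {y \<in> lower_feasible g q x. \<forall>y'\<in>lower_feasible g q x. f (x, y) \<le> f (x, y')}"

definition bilevel_feasible ::
    "('a \<times> 'b \<Rightarrow> real) \<Rightarrow> (nat \<Rightarrow> 'a \<times> 'b \<Rightarrow> real) \<Rightarrow> nat \<Rightarrow>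
     (nat \<Rightarrow> 'a \<times> 'b \<Rightarrow> real) \<Rightarrow> nat \<Rightarrow> ('a \<times> 'b) set" where
  "bilevel_feasible f g q G p =
     {(x, y). y \<in> lower_solutions f g q x \<and> (\<forall>j\<in>{1..p}. G j (x, y) \<le> 0)}"

definition bilevel_local_minimizer ::
    "('a::euclidean_space \<times> 'b::euclidean_space \<Rightarrow> real) \<Rightarrow> ('a \<times> 'b \<Rightarrow> real) \<Rightarrow>
     (nat \<Rightarrow> 'a \<times> 'b \<Rightarrow> real) \<Rightarrow> nat \<Rightarrow> (nat \<Rightarrow> 'a \<times> 'b \<Rightarrow> real) \<Rightarrow> nat \<Rightarrow> 'a \<times> 'b \<Rightarrow> bool" where
  "bilevel_local_minimizer F f g q G p z \<longleftrightarrow>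
     z \<in> bilevel_feasible f g q G p \<and>
     (\<forall>\<^sub>F u in nhds z. u \<in> bilevel_feasible f g q G p \<longrightarrow> F z \<le> F u)"

definition value_function ::
    "('a \<times> 'b \<Rightarrow> real) \<Rightarrow> (nat \<Rightarrow> 'a \<times> 'b \<Rightarrow> real) \<Rightarrow> nat \<Rightarrow> 'a \<Rightarrow> ereal" where
  "value_function f g q x = (INF y\<in>lower_feasible g q x. ereal (f (x, y)))"

definition value_gap ::
    "('a \<times> 'b \<Rightarrow> real) \<Rightarrow> (nat \<Rightarrow> 'a \<times> 'b \<Rightarrow> real) \<Rightarrow> nat \<Rightarrow> 'a \<times> 'b \<Rightarrow> ereal" where
  "value_gap f g q z = ereal (f z) - value_function f g q (fst z)"

definition reformulation_feasible ::
    "('a \<times> 'b \<Rightarrow> real) \<Rightarrow> (nat \<Rightarrow> 'a \<times> 'b \<Rightarrow> real) \<Rightarrow> nat \<Rightarrow>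
     (nat \<Rightarrow> 'a \<times> 'b \<Rightarrow> real) \<Rightarrow> nat \<Rightarrow> ('a \<times> 'b) set" where
  "reformulation_feasible f g q G p =
     {z. value_gap f g q z \<le> 0 \<and> (\<forall>i\<in>{1..q}. g i z \<le> 0) \<and> (\<forall>j\<in>{1..p}. G j z \<le> 0)}"

text \<open>Sums of sets below are Minkowski sums.\<close>

definition bilevel_T_quasinormal ::
    "('a::euclidean_space \<times> 'b::euclidean_space \<Rightarrow> real) \<Rightarrow> (nat \<Rightarrow> 'a \<times> 'b \<Rightarrow> real) \<Rightarrow> nat \<Rightarrow>
     (nat \<Rightarrow> 'a \<times> 'b \<Rightarrow> real) \<Rightarrow> nat \<Rightarrow> 'a \<times> 'b \<Rightarrow> bool" where
  "bilevel_T_quasinormal f g q G p z \<longleftrightarrow>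
     z \<in> reformulation_feasible f g q G p \<and>
     \<not> (\<exists>(\<mu>::real) (\<alpha>::nat \<Rightarrow> real) (\<beta>::nat \<Rightarrow> real).
          \<mu> \<ge> 0 \<and> (\<forall>i\<in>{1..q}. \<alpha> i \<ge> 0) \<and> (\<forall>j\<in>{1..p}. \<beta> j \<ge> 0) \<and>
          (\<mu> \<noteq> 0 \<or> (\<exists>i\<in>{1..q}. \<alpha> i \<noteq> 0) \<or> (\<exists>j\<in>{1..p}. \<beta> j \<noteq> 0)) \<and>
          0 \<in> (\<lambda>\<xi>. \<mu> *\<^sub>R \<xi>) ` tangential_subdiff (value_gap f g q) z
              + (\<Sum>i\<in>{1..q}. (\<lambda>\<xi>. \<alpha> i *\<^sub>R \<xi>) ` tangential_subdiff (\<lambda>u. ereal (g i u)) z)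
              + (\<Sum>j\<in>{1..p}. (\<lambda>\<xi>. \<beta> j *\<^sub>R \<xi>) ` tangential_subdiff (\<lambda>u. ereal (G j u)) z)
              + limiting_normal_cone UNIV z \<and>
          (\<exists>w::nat \<Rightarrow> 'a \<times> 'b. w \<longlonglongrightarrow> z \<and>
             (\<forall>k. w k \<notin> reformulation_feasible f g q G p \<and>
                  (\<mu> > 0 \<longrightarrow> ereal \<mu> * value_gap f g q (w k) > 0) \<and>
                  (\<forall>i\<in>{1..q}. \<alpha> i > 0 \<longrightarrow> \<alpha> i * g i (w k) > 0) \<and>
                  (\<forall>j\<in>{1..p}. \<beta> j > 0 \<longrightarrow> \<beta> j * G j (w k) > 0))))"

end

theory Submission
  imports Defs
begin

text \<open>
  The minimisers \<open>x\<^sub>k\<close> of the quadratic penalty functions \<open>F + k/2 \<Sum> (h\<^sub>i)\<^sub>+\<^sup>2 + \<bar>\<cdot> - z\<bar>\<^sup>2/2\<close> over a small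
  ball converge to the local minimiser \<open>z\<close>, and \<open>k (h\<^sub>i(x\<^sub>k))\<^sub>+\<close> are approximate multipliers. Clarke
  regularity bounds the difference quotients near \<open>z\<close> by the directional derivatives at \<open>z\<close>, so
  after normalisation the limit is a Fritz John inequality between sublinear functions, which a
  separation argument turns into a relation between subgradients. A multiplier that is positive in the
  limit belongs to a constraint violated by all late \<open>x\<^sub>k\<close>; quasinormality therefore forbids that
  the weight of the objective vanishes.
\<close>

section \<open>Sublinear functions and their subgradients at the origin\<close>

definition sublinear :: "('a::real_vector \<Rightarrow> real) \<Rightarrow> bool" where
  "sublinear p \<longleftrightarrow> convex_on UNIV p \<and> (\<forall>t>0. \<forall>v. p (t *\<^sub>R v) = t * p v)"

text \<open>This is the convex subdifferential of \<open>p\<close> at the origin. For sublinear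
  \<open>p\<close> it is the set whose support function is \<open>p\<close>.\<close>

definition dominated :: "('a::real_inner \<Rightarrow> real) \<Rightarrow> 'a set" where
  "dominated p = {\<xi>. \<forall>v. \<xi> \<bullet> v \<le> p v}"

lemma sublinear_scale: "sublinear p \<Longrightarrow> t > 0 \<Longrightarrow> p (t *\<^sub>R v) = t * p v"
  by (simp add: sublinear_def)

lemma sublinear_zero: "sublinear p \<Longrightarrow> p 0 = 0"
  using sublinear_scale[of p 2 0] by simp

text \<open>Hahn-Banach in finite dimension: a hyperplane separating the strict epigraph
  \<open>S\<close> from the boundary point \<open>(w, p w)\<close> has a slope \<open>\<xi>\<close>
  for which \<open>w\<close> maximises \<open>\<xi> \<bullet> v - p v\<close>. Homogeneity forces
  this maximum to be 0.\<close>

lemma sublinear_attained: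
  fixes p :: "'a::euclidean_space \<Rightarrow> real"
  assumes p: "sublinear p"
  shows "\<exists>\<xi>\<in>dominated p. \<xi> \<bullet> w = p w"
proof -
  define S where "S = {(v, r). p v < r}"
  have cv: "convex_on UNIV p" using p by (simp add: sublinear_def)
  have "convex S"
    unfolding convex_alt
  proof (intro ballI allI impI)
    fix x y :: "'a \<times> real" and u :: real
    assume x: "x \<in> S" and y: "y \<in> S" and u: "0 \<le> u \<and> u \<le> 1"
    have "p ((1 - u) *\<^sub>R fst x + u *\<^sub>R fst y) \<le> (1 - u) * p (fst x) + u * p (fst y)"
      using convex_onD[OF cv, of u "fst x" "fst y"] u by simp
    also have "\<dots> < (1 - u) * snd x + u * snd y"
    proof (cases "u = 0")
      case True
      then show ?thesis using x by (auto simp: S_def)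
    next
      case False
      have "(1 - u) * p (fst x) \<le> (1 - u) * snd x"
        using x u by (intro mult_left_mono) (auto simp: S_def)
      moreover have "u * p (fst y) < u * snd y"
        using y u False by (intro mult_strict_left_mono) (auto simp: S_def)
      ultimately show ?thesis by simp
    qed
    finally show "(1 - u) *\<^sub>R x + u *\<^sub>R y \<in> S"
      by (simp add: S_def split_beta)
  qed
  moreover have "S \<noteq> {}"
    by (auto simp: S_def intro: lt_ex gt_ex)
  moreover have "S \<inter> {(w, p w)} = {}" by (auto simp: S_def)
  ultimately obtain a :: "'a \<times> real" and b where a: "a \<noteq> 0"
    and S: "\<forall>x\<in>S. a \<bullet> x \<le> b" and T: "\<forall>x\<in>{(w, p w)}. a \<bullet> x \<ge> b"
    using separating_hyperplane_sets[of S "{(w, p w)}"] by (metis convex_singleton insert_not_empty)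
  obtain c s where as: "a = (c, s)" by (cases a)
  have sep: "c \<bullet> v + s * r \<le> c \<bullet> w + s * p w" if "p v < r" for v r
  proof -
    have "a \<bullet> (v, r) \<le> b" using S that by (auto simp: S_def)
    also have "b \<le> a \<bullet> (w, p w)" using T by auto
    finally show ?thesis by (simp add: as)
  qed
  \<comment> \<open>The hyperplane is not vertical: since \<open>p\<close> is finite everywhere, the
    epigraph has points above \<open>w + c\<close>, and these would violate separation by a purely
    horizontal normal \<open>c\<close>. As the epigraph is unbounded upwards, the sign of
    \<open>s\<close> is then negative.\<close>
  have s0: "s \<noteq> 0"
  proof
    assume "s = 0"
    with sep[of "w + c" "p (w + c) + 1"] have "c \<bullet> c \<le> 0" by (simp add: inner_right_distrib)
    then have "c = 0" by (metis antisym inner_eq_zero_iff inner_ge_zero)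
    with \<open>s = 0\<close> a show False by (simp add: as zero_prod_def)
  qed
  have "s < 0" using sep[of w "p w + 1"] s0 by (simp add: algebra_simps)
  define \<xi> where "\<xi> = (- 1 / s) *\<^sub>R c"
  have c: "c = (- s) *\<^sub>R \<xi>" using s0 by (simp add: \<xi>_def)
  \<comment> \<open>The points \<open>(v, p v)\<close> lie only on the boundary of \<open>S\<close>,
    so they are approached from above by \<open>p v + e\<close>.\<close>
  have sep2: "\<xi> \<bullet> v - p v \<le> \<xi> \<bullet> w - p w" for v
  proof (rule field_le_epsilon)
    fix e :: real assume "e > 0"
    have "(-s) * (\<xi> \<bullet> v - p v - e) \<le> (-s) * (\<xi> \<bullet> w - p w)"
      using sep[of v "p v + e"] \<open>e > 0\<close> by (simp add: c algebra_simps)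
    then show "\<xi> \<bullet> v - p v \<le> \<xi> \<bullet> w - p w + e" using \<open>s < 0\<close>
      by (simp add: mult_le_cancel_left)
  qed
  \<comment> \<open>Comparing the maximiser \<open>w\<close> with 0 and with its own multiple
    \<open>2 *\<^sub>R w\<close> pins the maximal value to 0.\<close>
  have w_ge: "\<xi> \<bullet> w \<ge> p w" using sep2[of 0] sublinear_zero[OF p] by simp
  have w_le: "\<xi> \<bullet> w \<le> p w" using sep2[of "2 *\<^sub>R w"] sublinear_scale[OF p, of 2 w] by simp
  have "\<xi> \<bullet> v \<le> p v" for v using sep2[of v] w_ge w_le by simp
  then show ?thesis using w_ge w_le by (auto simp: dominated_def intro!: bexI[of _ \<xi>])
qed

lemma convex_dominated: "convex (dominated p)"
proof -
  have "dominated p = (\<Inter>v. {\<xi>. v \<bullet> \<xi> \<le> p v})" by (auto simp: dominated_def inner_commute)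
  then show ?thesis by (simp add: convex_INT convex_halfspace_le)
qed

text \<open>Closedness comes from the description as an intersection of halfspaces; boundedness from
  testing against \<open>b\<close> and \<open>- b\<close> for each basis vector, which bounds every
  coordinate.\<close>

lemma compact_dominated:
  fixes p :: "'a::euclidean_space \<Rightarrow> real"
  shows "compact (dominated p)"
proof -
  have "dominated p = (\<Inter>v. {\<xi>. v \<bullet> \<xi> \<le> p v})" by (auto simp: dominated_def inner_commute)
  then have "closed (dominated p)" by (simp add: closed_INT closed_halfspace_le)
  moreover have "norm \<xi> \<le> (\<Sum>b\<in>Basis. \<bar>p b\<bar> + \<bar>p (- b)\<bar>)" if "\<xi> \<in> dominated p" for \<xi>
  proof -
    have "\<bar>\<xi> \<bullet> b\<bar> \<le> \<bar>p b\<bar> + \<bar>p (- b)\<bar>" for b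
    proof -
      have "\<xi> \<bullet> b \<le> p b" "\<xi> \<bullet> (- b) \<le> p (- b)" using that by (auto simp only: dominated_def)
      then show ?thesis by simp
    qed
    then show ?thesis by (intro order_trans[OF norm_le_l1] sum_mono)
  qed
  then have "bounded (dominated p)" unfolding bounded_iff by blast
  ultimately show ?thesis by (simp add: compact_eq_bounded_closed)
qed

lemma compact_set_sum:
  fixes S :: "'i \<Rightarrow> 'a::real_normed_vector set"
  assumes "finite I" "\<And>i. i \<in> I \<Longrightarrow> compact (S i)"
  shows "compact (\<Sum>i\<in>I. S i)"
  using assms
proof (induction I)
  case empty
  then show ?case by (simp add: set_zero)
next
  case (insert j I)
  have "S j + (\<Sum>i\<in>I. S i) = {x + y | x y. x \<in> S j \<and> y \<in> (\<Sum>i\<in>I. S i)}"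
    by (auto simp: set_plus_def)
  then show ?case using insert by (simp add: compact_sums)
qed

text \<open>If \<open>0\<close> were not in the Minkowski sum, a separating direction would make the weighted sum
  of the support functions negative.\<close>

lemma sublinear_combination_zero:
  fixes p :: "'i \<Rightarrow> 'a::euclidean_space \<Rightarrow> real"
  assumes fin: "finite I" and p: "\<And>i. i \<in> I \<Longrightarrow> sublinear (p i)"
    and nonneg: "\<And>v. 0 \<le> (\<Sum>i\<in>I. c i * p i v)"
  obtains \<xi> where "\<And>i. i \<in> I \<Longrightarrow> \<xi> i \<in> dominated (p i)" "(\<Sum>i\<in>I. c i *\<^sub>R \<xi> i) = 0"
proof -
  define K where "K = (\<Sum>i\<in>I. (\<lambda>\<xi>. c i *\<^sub>R \<xi>) ` dominated (p i))"
  have "compact K" unfolding K_def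
    by (intro compact_set_sum fin compact_scaling compact_dominated)
  have "convex K" unfolding K_def
    by (intro convex_set_sum convex_scaling convex_dominated)
  have K: "K = {\<Sum>i\<in>I. s i | s. \<forall>i\<in>I. s i \<in> (\<lambda>\<xi>. c i *\<^sub>R \<xi>) ` dominated (p i)}"
    unfolding K_def by (rule set_sum_alt[OF fin])
  have "0 \<in> K"
  proof (rule ccontr)
    assume "0 \<notin> K"
    then obtain a b where b: "b > 0" and sep: "\<And>x. x \<in> K \<Longrightarrow> a \<bullet> x > b"
      using separating_hyperplane_closed_0[of K] \<open>compact K\<close> \<open>convex K\<close> compact_imp_closed by metis
    \<comment> \<open>In the direction \<open>- a\<close> each support function is attained. The
      weighted sum of the attaining subgradients is a point of \<open>K\<close>, so its product with
      \<open>- a\<close> is negative, although it equals the sum assumed nonnegative.\<close>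
    have "\<forall>i\<in>I. \<exists>\<xi>. \<xi> \<in> dominated (p i) \<and> \<xi> \<bullet> (- a) = p i (- a)"
      using sublinear_attained[OF p] by blast
    then obtain \<xi> where \<xi>: "\<And>i. i \<in> I \<Longrightarrow> \<xi> i \<in> dominated (p i)"
      "\<And>i. i \<in> I \<Longrightarrow> \<xi> i \<bullet> (- a) = p i (- a)"
      by metis
    have "(\<Sum>i\<in>I. c i *\<^sub>R \<xi> i) \<in> K" unfolding K using \<xi> by blast
    from sep[OF this] b have "0 > (\<Sum>i\<in>I. c i *\<^sub>R \<xi> i) \<bullet> (- a)" by (simp add: inner_commute)
    also have "(\<Sum>i\<in>I. c i *\<^sub>R \<xi> i) \<bullet> (- a) = (\<Sum>i\<in>I. c i * p i (- a))"
      unfolding inner_sum_left by (rule sum.cong) (simp_all add: \<xi>(2) del: inner_minus_right)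
    finally show False using nonneg[of "- a"] by simp
  qed
  then obtain s where s: "\<forall>i\<in>I. s i \<in> (\<lambda>\<xi>. c i *\<^sub>R \<xi>) ` dominated (p i)" and s0: "0 = (\<Sum>i\<in>I. s i)"
    unfolding K by blast
  from s obtain \<xi> where \<xi>: "\<And>i. i \<in> I \<Longrightarrow> \<xi> i \<in> dominated (p i)" "\<And>i. i \<in> I \<Longrightarrow> s i = c i *\<^sub>R \<xi> i"
    unfolding image_iff by metis
  show thesis by (rule that[of \<xi>]) (use \<xi> s0 in auto)
qed

section \<open>Quadratic penalties and the enhanced Fritz John condition\<close>

text \<open>Uniformity in the base point is what survives along the penalty minimisers; for a Clarke
  regular function it holds with \<open>p\<close> the directional derivative.\<close>

definition strict_upper_slope :: "('a::euclidean_space \<Rightarrow> real) \<Rightarrow> 'a \<Rightarrow> ('a \<Rightarrow> real) \<Rightarrow> bool" where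
  "strict_upper_slope h z p \<longleftrightarrow>
     (\<forall>v. \<forall>\<epsilon>>0. \<forall>\<^sub>F u in nhds z. \<forall>\<^sub>F t in at_right 0. h (u + t *\<^sub>R v) \<le> h u + t * (p v + \<epsilon>))"

text \<open>The proximal term makes \<open>z\<close> the only possible limit of the minimisers even
  if \<open>z\<close> is not a strict minimiser. The halves cancel against the factor 2 from
  differentiating squares.\<close>

definition penalized ::
    "('a::real_inner \<Rightarrow> real) \<Rightarrow> ('i \<Rightarrow> 'a \<Rightarrow> real) \<Rightarrow> 'i set \<Rightarrow> 'a \<Rightarrow> real \<Rightarrow> 'a \<Rightarrow> real" where
  "penalized F h I z c u =
     F u + c / 2 * (\<Sum>i\<in>I. (max 0 (h i u))\<^sup>2) + ((u - z) \<bullet> (u - z)) / 2"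

text \<open>Comparison with \<open>z\<close>, where the penalty vanishes, bounds the penalty term.
  As its parameter grows, every cluster point \<open>l\<close> is feasible, hence
  \<open>F z \<le> F l\<close>, and the proximal term leaves no room for \<open>l\<close> to differ
  from \<open>z\<close>.\<close>

lemma penalty_minimizers_converge:
  fixes F :: "'a::euclidean_space \<Rightarrow> real" and h :: "'i \<Rightarrow> 'a \<Rightarrow> real"
  assumes fin: "finite I" and r: "r > 0"
    and contF: "continuous_on (cball z r) F"
    and conth: "\<And>i. i \<in> I \<Longrightarrow> continuous_on (cball z r) (h i)"
    and feas: "\<And>i. i \<in> I \<Longrightarrow> h i z \<le> 0"
    and min: "\<And>u. u \<in> cball z r \<Longrightarrow> (\<And>i. i \<in> I \<Longrightarrow> h i u \<le> 0) \<Longrightarrow> F z \<le> F u"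
  obtains x c where "x \<longlonglongrightarrow> z" "\<And>k::nat. c k \<ge> 0" "\<And>k. x k \<in> cball z r"
    "\<And>k u. u \<in> cball z r \<Longrightarrow> penalized F h I z (c k) (x k) \<le> penalized F h I z (c k) u"
proof -
  define \<Phi> where "\<Phi> = (\<lambda>k::nat. penalized F h I z (real k))"
  have ne: "cball z r \<noteq> {}" using r by auto
  have "\<exists>x\<in>cball z r. \<forall>u\<in>cball z r. \<Phi> k x \<le> \<Phi> k u" for k
    unfolding \<Phi>_def penalized_def
    by (intro continuous_attains_inf continuous_intros contF conth ne compact_cball) auto
  then obtain y where y: "\<And>k. y k \<in> cball z r" "\<And>k u. u \<in> cball z r \<Longrightarrow> \<Phi> k (y k) \<le> \<Phi> k u"
    by metis
  \<comment> \<open>The minimum of \<open>F\<close> over the ball is the lower bound that turns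
    \<open>bound\<close> into an estimate of the penalty alone.\<close>
  obtain m where m: "m \<in> cball z r" "\<And>u. u \<in> cball z r \<Longrightarrow> F m \<le> F u"
    using continuous_attains_inf[OF compact_cball ne contF] by blast
  have zin: "z \<in> cball z r" using r by simp
  have \<Phi>z: "\<Phi> k z = F z" for k
  proof -
    have "(\<Sum>i\<in>I. (max 0 (h i z))\<^sup>2) = 0" using feas by (intro sum.neutral) auto
    then show ?thesis by (simp add: \<Phi>_def penalized_def)
  qed
  have bound: "F (y k) + real k / 2 * (\<Sum>i\<in>I. (max 0 (h i (y k)))\<^sup>2) + ((y k - z) \<bullet> (y k - z)) / 2 \<le> F z" for k
    using y(2)[OF zin, of k] unfolding \<Phi>z by (simp add: \<Phi>_def penalized_def)
  obtain l s where l: "l \<in> cball z r" and s: "strict_mono s" and lim: "(y \<circ> s) \<longlonglongrightarrow> l"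
    using compact_cball[of z r] y(1) unfolding compact_def by blast
  have tend: "(\<lambda>k. f (y (s k))) \<longlonglongrightarrow> f l" if "continuous_on (cball z r) f" for f :: "'a \<Rightarrow> real"
    using continuous_on_tendsto_compose[OF that lim l] y(1) by (simp add: o_def)
  have pen_nonneg: "0 \<le> (\<Sum>i\<in>I. (max 0 (h i u))\<^sup>2)" for u by (intro sum_nonneg) auto
  have sinf: "filterlim (\<lambda>k. real (s k)) at_top sequentially"
    using filterlim_compose[OF filterlim_real_sequentially filterlim_subseq[OF s]] by (simp add: o_def)
  have feas_l: "h i l \<le> 0" if i: "i \<in> I" for i
  proof -
    have le: "real k * (max 0 (h i (y k)))\<^sup>2 \<le> 2 * (F z - F m)" for k
    proof -
      have "(max 0 (h i (y k)))\<^sup>2 \<le> (\<Sum>i\<in>I. (max 0 (h i (y k)))\<^sup>2)"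
        using i fin by (intro member_le_sum) auto
      then have "real k * (max 0 (h i (y k)))\<^sup>2 \<le> real k * (\<Sum>i\<in>I. (max 0 (h i (y k)))\<^sup>2)"
        by (intro mult_left_mono) auto
      moreover have "0 \<le> (y k - z) \<bullet> (y k - z)" by simp
      ultimately show ?thesis using bound[of k] m(2)[OF y(1), of k] by argo
    qed
    have "\<forall>\<^sub>F k in sequentially. (max 0 (h i (y (s k))))\<^sup>2 \<le> 2 * (F z - F m) / real (s k)"
      using filterlim_at_top_dense[THEN iffD1, OF sinf, rule_format, of 0]
    proof eventually_elim
      case (elim k)
      then show ?case using le[of "s k"] by (simp add: field_simps)
    qed
    moreover have "(\<lambda>k. 2 * (F z - F m) / real (s k)) \<longlonglongrightarrow> 0"
      by (rule tendsto_divide_0[OF tendsto_const filterlim_at_top_imp_at_infinity[OF sinf]])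
    moreover have "(\<lambda>k. (max 0 (h i (y (s k))))\<^sup>2) \<longlonglongrightarrow> (max 0 (h i l))\<^sup>2"
      by (intro tendsto_power tendsto_max tendsto_const tend conth i)
    ultimately have "(max 0 (h i l))\<^sup>2 \<le> 0"
      using tendsto_le[OF trivial_limit_sequentially] by blast
    then have "max 0 (h i l) = 0" by simp
    then show ?thesis by (simp add: max_def split: if_splits)
  qed
  have "(\<lambda>k. F (y (s k)) + ((y (s k) - z) \<bullet> (y (s k) - z)) / 2) \<longlonglongrightarrow> F l + ((l - z) \<bullet> (l - z)) / 2"
    using lim by (intro tendsto_add tendsto_divide tendsto_inner tendsto_diff tend contF tendsto_const)
      (auto simp: o_def)
  moreover have "F (y k) + ((y k - z) \<bullet> (y k - z)) / 2 \<le> F z" for k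
    using bound[of k] mult_nonneg_nonneg[of "real k / 2", OF _ pen_nonneg[of "y k"]] by simp
  ultimately have "F l + ((l - z) \<bullet> (l - z)) / 2 \<le> F z"
    by (intro LIMSEQ_le_const2) auto
  moreover have "F z \<le> F l" by (intro min l feas_l)
  ultimately have "(l - z) \<bullet> (l - z) \<le> 0" by simp
  then have "l = z" by (metis antisym inner_eq_zero_iff inner_ge_zero right_minus_eq)
  show thesis
  \<comment> \<open>Divergence of the penalty parameters has served its purpose in
    \<open>feas_l\<close>; the later stationarity argument only asks for their sign.\<close>
  proof (rule that[of "y \<circ> s" "\<lambda>k. real (s k)"])
    show "(y \<circ> s) \<longlonglongrightarrow> z" using lim \<open>l = z\<close> by simp
  qed (use y in \<open>auto simp: \<Phi>_def\<close>)
qed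

text \<open>Squaring the positive part keeps the bound one-sided:
  \<open>h(x + t v) \<le> h(x) + t c\<close> gives \<open>h(x + t v)\<^sub>+\<^sup>2 \<le> (h(x)\<^sub>+ + t c)\<^sup>2\<close> whatever the sign of \<open>c\<close>, so no
  differentiability away from the reference point is needed.\<close>

lemma penalized_stationary:
  fixes F :: "'a::euclidean_space \<Rightarrow> real" and h :: "'i \<Rightarrow> 'a \<Rightarrow> real"
  assumes fin: "finite I" and c: "c \<ge> 0"
    and min: "\<forall>\<^sub>F u in nhds x. penalized F h I z c x \<le> penalized F h I z c u"
    and F: "\<forall>\<^sub>F t in at_right 0. F (x + t *\<^sub>R v) \<le> F x + t * P"
    and h: "\<And>i. i \<in> I \<Longrightarrow> \<forall>\<^sub>F t in at_right 0. h i (x + t *\<^sub>R v) \<le> h i x + t * p i"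
  shows "0 \<le> P + (\<Sum>i\<in>I. c * max 0 (h i x) * p i) + (x - z) \<bullet> v"
proof -
  define s where "s = (\<lambda>i. max 0 (h i x))"
  \<comment> \<open>\<open>t * R t\<close> bounds from above the increment of the penalized function
    from \<open>x\<close> to \<open>x + t *\<^sub>R v\<close>; the terms of \<open>R\<close>
    carrying a factor \<open>t\<close> are the second-order remainders and vanish in the
    limit.\<close>
  define R where "R = (\<lambda>t. P + c * (\<Sum>i\<in>I. s i * p i + t * (p i)\<^sup>2 / 2) + (x - z) \<bullet> v + t * (v \<bullet> v) / 2)"
  have "((\<lambda>t. x + t *\<^sub>R v) \<longlongrightarrow> x + 0 *\<^sub>R v) (at_right 0)"
    by (intro tendsto_intros)
  then have "\<forall>\<^sub>F t in at_right 0. penalized F h I z c x \<le> penalized F h I z c (x + t *\<^sub>R v)"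
    using filterlim_iff[THEN iffD1, rule_format, OF _ min, of "\<lambda>t. x + t *\<^sub>R v"] by simp
  moreover have "\<forall>\<^sub>F t in at_right 0. \<forall>i\<in>I. h i (x + t *\<^sub>R v) \<le> h i x + t * p i"
    using h by (intro eventually_ball_finite fin) auto
  moreover have "\<forall>\<^sub>F t in at_right (0::real). t > 0" by (rule eventually_at_right_less)
  ultimately have "\<forall>\<^sub>F t in at_right 0. 0 \<le> R t"
    using F
  proof eventually_elim
    case (elim t)
    have sq: "(max 0 (h i (x + t *\<^sub>R v)))\<^sup>2 \<le> (s i + t * p i)\<^sup>2" if "i \<in> I" for i
    proof (cases "h i (x + t *\<^sub>R v) \<le> 0")
      \<comment> \<open>Here \<open>0 < h i (x + t *\<^sub>R v) \<le> s i + t * p i\<close>, so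
        squaring is monotone. In the other case the left-hand square is 0.\<close>
      case False
      then show ?thesis using elim(2) that unfolding s_def by (intro power_mono) fastforce+
    qed simp
    have "(\<Sum>i\<in>I. (max 0 (h i (x + t *\<^sub>R v)))\<^sup>2) \<le> (\<Sum>i\<in>I. (s i)\<^sup>2 + 2 * t * (s i * p i + t * (p i)\<^sup>2 / 2))"
      by (intro sum_mono order_trans[OF sq]) (auto simp: power2_eq_square algebra_simps)
    also have "\<dots> = (\<Sum>i\<in>I. (s i)\<^sup>2) + 2 * t * (\<Sum>i\<in>I. s i * p i + t * (p i)\<^sup>2 / 2)"
      by (subst sum.distrib) (simp only: sum_distrib_left)
    finally have penalty: "c / 2 * (\<Sum>i\<in>I. (max 0 (h i (x + t *\<^sub>R v)))\<^sup>2)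
        \<le> c / 2 * (\<Sum>i\<in>I. (s i)\<^sup>2) + c / 2 * (2 * t * (\<Sum>i\<in>I. s i * p i + t * (p i)\<^sup>2 / 2))"
      using c unfolding distrib_left[of "c / 2", symmetric] by (intro mult_left_mono) auto
    have "x + t *\<^sub>R v - z = (x - z) + t *\<^sub>R v" by simp
    then have proximal: "(x + t *\<^sub>R v - z) \<bullet> (x + t *\<^sub>R v - z)
        = (x - z) \<bullet> (x - z) + (2 * t * ((x - z) \<bullet> v) + t * t * (v \<bullet> v))"
      by (simp only: inner_add_left inner_add_right inner_scaleR_left inner_scaleR_right
          inner_commute[of v "x - z"]) (simp add: algebra_simps)
    have tR: "t * R t = t * P + c / 2 * (2 * t * (\<Sum>i\<in>I. s i * p i + t * (p i)\<^sup>2 / 2))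
        + (2 * t * ((x - z) \<bullet> v) + t * t * (v \<bullet> v)) / 2"
      unfolding R_def by algebra
    have total: "F x + c / 2 * (\<Sum>i\<in>I. (s i)\<^sup>2) + ((x - z) \<bullet> (x - z)) / 2
        \<le> F (x + t *\<^sub>R v) + c / 2 * (\<Sum>i\<in>I. (max 0 (h i (x + t *\<^sub>R v)))\<^sup>2)
          + ((x + t *\<^sub>R v - z) \<bullet> (x + t *\<^sub>R v - z)) / 2"
      using elim(1) by (simp only: penalized_def s_def)
    \<comment> \<open>The bookkeeping is linear once the long expressions are abstracted to
      variables.\<close>
    have "0 \<le> w" if "A \<le> B + C" "D' = D + E" "w = a + C + E / 2"
        "y + B + D / 2 \<le> y' + A + D' / 2" "y' \<le> y + a" for A B C D D' E w a y y' :: real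
      using that by linarith
    from this[OF penalty proximal tR total elim(4)] have "0 \<le> t * R t" .
    then show ?case using elim(3) by (simp add: zero_le_mult_iff)
  qed
  moreover have "(R \<longlongrightarrow> P + c * (\<Sum>i\<in>I. s i * p i + 0 * (p i)\<^sup>2 / 2) + (x - z) \<bullet> v + 0 * (v \<bullet> v) / 2) (at_right 0)"
    unfolding R_def by (intro tendsto_intros) auto
  ultimately have "0 \<le> P + c * (\<Sum>i\<in>I. s i * p i + 0 * (p i)\<^sup>2 / 2) + (x - z) \<bullet> v + 0 * (v \<bullet> v) / 2"
    by (intro tendsto_lowerbound[where F = "at_right (0::real)"]) auto
  then show ?thesis by (simp add: s_def sum_distrib_left mult.assoc)
qed

text \<open>Bolzano-Weierstrass is applied to one index after another; limits already obtained
  survive each further refinement.\<close>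

lemma bounded_finite_family_subseq:
  fixes X :: "'i \<Rightarrow> nat \<Rightarrow> real"
  assumes "finite I" "\<And>i. i \<in> I \<Longrightarrow> bounded (range (X i))"
  shows "\<exists>r l. strict_mono r \<and> (\<forall>i\<in>I. (X i \<circ> r) \<longlonglongrightarrow> l i)"
  using assms
proof (induction I)
  case empty
  then show ?case using strict_mono_id by auto
next
  case (insert j I)
  then obtain r l where r: "strict_mono r" and l: "\<And>i. i \<in> I \<Longrightarrow> (X i \<circ> r) \<longlonglongrightarrow> l i" by blast
  have "bounded (range (X j \<circ> r))"
    using insert.prems[of j] by (auto intro: bounded_subset)
  then obtain m s where s: "strict_mono s" and m: "((X j \<circ> r) \<circ> s) \<longlonglongrightarrow> m"
    using bounded_imp_convergent_subsequence by blast
  have "(X i \<circ> (r \<circ> s)) \<longlonglongrightarrow> (l(j := m)) i" if "i \<in> insert j I" for i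
    using that m LIMSEQ_subseq_LIMSEQ[OF l s] insert.hyps by (auto simp: o_assoc)
  then show ?case using strict_mono_o[OF r s] by blast
qed

text \<open>Stationarity of the penalty minimisers has weights 1 for \<open>F\<close> and
  \<open>m i k\<close> for the constraints. Divided by their total they lie in a simplex, and a
  convergent subsequence gives \<open>a\<close> and \<open>\<mu>\<close>. Since \<open>m i k\<close>
  vanishes unless \<open>h i\<close> is violated at \<open>x0 k\<close>, a positive limit certifies
  violation along the sequence.\<close>

lemma enhanced_fritz_john:
  fixes F :: "'a::euclidean_space \<Rightarrow> real" and h :: "'i \<Rightarrow> 'a \<Rightarrow> real"
  assumes fin: "finite I" and r: "r > 0"
    and contF: "continuous_on (cball z r) F"
    and conth: "\<And>i. i \<in> I \<Longrightarrow> continuous_on (cball z r) (h i)"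
    and feas: "\<And>i. i \<in> I \<Longrightarrow> h i z \<le> 0"
    and min: "\<And>u. u \<in> cball z r \<Longrightarrow> (\<And>i. i \<in> I \<Longrightarrow> h i u \<le> 0) \<Longrightarrow> F z \<le> F u"
    and F: "strict_upper_slope F z P"
    and h: "\<And>i. i \<in> I \<Longrightarrow> strict_upper_slope (h i) z (p i)"
  obtains a \<mu> w where "a \<ge> 0" "\<And>i. i \<in> I \<Longrightarrow> \<mu> i \<ge> 0" "a + (\<Sum>i\<in>I. \<mu> i) = 1"
    "\<And>v. 0 \<le> a * P v + (\<Sum>i\<in>I. \<mu> i * p i v)"
    "w \<longlonglongrightarrow> z" "\<And>k::nat. w k \<in> cball z r"
    "\<And>i k. i \<in> I \<Longrightarrow> \<mu> i > 0 \<Longrightarrow> h i (w k) > 0"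
proof -
  obtain x0 c0 where x0: "x0 \<longlonglongrightarrow> z" and c0: "\<And>k::nat. c0 k \<ge> 0" and ball: "\<And>k. x0 k \<in> cball z r"
    and min0: "\<And>k u. u \<in> cball z r \<Longrightarrow> penalized F h I z (c0 k) (x0 k) \<le> penalized F h I z (c0 k) u"
    by (rule penalty_minimizers_converge[OF fin r contF conth feas min]) blast+
  define m where "m = (\<lambda>i k. c0 k * max 0 (h i (x0 k)))"
  \<comment> \<open>The summand 1 is the weight of the objective; it also keeps the divisor away
    from 0 when all constraints hold at \<open>x0 k\<close>.\<close>
  define \<delta> where "\<delta> = (\<lambda>k. 1 + (\<Sum>i\<in>I. m i k))"
  have m_nonneg: "0 \<le> m i k" for i k using c0 by (simp add: m_def)
  have \<delta>_ge: "\<delta> k \<ge> 1" for k by (simp add: \<delta>_def sum_nonneg m_nonneg)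
  have "bounded (range (\<lambda>k. m i k / \<delta> k))" if "i \<in> I" for i
  proof -
    have "m i k \<le> \<delta> k" for k
      using member_le_sum[OF that, of "\<lambda>i. m i k"] m_nonneg fin by (simp add: \<delta>_def add_increasing)
    then have "norm (m i k / \<delta> k) \<le> 1" for k
      using m_nonneg[of i k] \<delta>_ge[of k] by (simp add: divide_le_eq_1)
    then show ?thesis by (auto simp: bounded_iff)
  qed
  then obtain s \<mu> where s: "strict_mono s" and \<mu>: "\<And>i. i \<in> I \<Longrightarrow> ((\<lambda>k. m i k / \<delta> k) \<circ> s) \<longlonglongrightarrow> \<mu> i"
    using bounded_finite_family_subseq[OF fin, of "\<lambda>i k. m i k / \<delta> k"] by blast
  define x where "x = x0 \<circ> s"
  define b where "b = (\<lambda>i k. m i (s k) / \<delta> (s k))"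
  have x: "x \<longlonglongrightarrow> z" unfolding x_def by (rule LIMSEQ_subseq_LIMSEQ[OF x0 s])
  have b: "b i \<longlonglongrightarrow> \<mu> i" if "i \<in> I" for i using \<mu>[OF that] by (simp add: b_def o_def)
  have b_nonneg: "0 \<le> b i k" for i k using m_nonneg \<delta>_ge[of "s k"] by (simp add: b_def)
  define a where "a = 1 - (\<Sum>i\<in>I. \<mu> i)"
  have "1 / \<delta> (s k) = 1 - (\<Sum>i\<in>I. b i k)" for k
    using \<delta>_ge[of "s k"] unfolding b_def sum_divide_distrib[symmetric] by (simp add: field_simps \<delta>_def)
  then have a: "(\<lambda>k. 1 / \<delta> (s k)) \<longlonglongrightarrow> a" unfolding a_def by (auto intro!: tendsto_intros b)
  have a_nonneg: "a \<ge> 0"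
    using LIMSEQ_le_const[OF a, of 0] \<delta>_ge by (meson divide_nonneg_nonneg order_trans zero_le_one)
  have \<mu>_nonneg: "\<mu> i \<ge> 0" if "i \<in> I" for i
    using LIMSEQ_le_const[OF b[OF that], of 0] b_nonneg by blast
  have slope: "0 \<le> a * P v + (\<Sum>i\<in>I. \<mu> i * p i v)" for v
  proof (rule field_le_epsilon)
    fix e :: real assume e: "e > 0"
    have "\<forall>\<^sub>F k in sequentially. x k \<in> ball z r"
      using r by (intro topological_tendstoD[OF x]) auto
    moreover have "\<forall>\<^sub>F k in sequentially. \<forall>\<^sub>F t in at_right 0. F (x k + t *\<^sub>R v) \<le> F (x k) + t * (P v + e)"
      using F e x unfolding strict_upper_slope_def filterlim_iff by blast
    moreover have "\<forall>\<^sub>F k in sequentially. \<forall>i\<in>I. \<forall>\<^sub>F t in at_right 0. h i (x k + t *\<^sub>R v) \<le> h i (x k) + t * (p i v + e)"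
      using h e x unfolding strict_upper_slope_def filterlim_iff by (intro eventually_ball_finite fin) blast
    ultimately have ev: "\<forall>\<^sub>F k in sequentially.
      0 \<le> 1 / \<delta> (s k) * (P v + e) + (\<Sum>i\<in>I. b i k * (p i v + e)) + 1 / \<delta> (s k) * ((x k - z) \<bullet> v)"
    proof eventually_elim
      case (elim k)
      have "\<forall>\<^sub>F u in nhds (x k). u \<in> ball z r" using elim(1) by (intro eventually_nhds_in_open) auto
      then have "\<forall>\<^sub>F u in nhds (x k). penalized F h I z (c0 (s k)) (x k) \<le> penalized F h I z (c0 (s k)) u"
        by eventually_elim (use min0 in \<open>auto simp: x_def\<close>)
      then have "0 \<le> P v + e + (\<Sum>i\<in>I. c0 (s k) * max 0 (h i (x k)) * (p i v + e)) + (x k - z) \<bullet> v"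
        using elim by (intro penalized_stationary[OF fin c0]) auto
      then have "0 \<le> 1 / \<delta> (s k) * (P v + e + (\<Sum>i\<in>I. m i (s k) * (p i v + e)) + (x k - z) \<bullet> v)"
        using \<delta>_ge[of "s k"] by (intro mult_nonneg_nonneg) (auto simp: m_def x_def)
      then show ?case by (simp add: b_def sum_divide_distrib add_divide_distrib)
    qed
    have "(\<lambda>k. 1 / \<delta> (s k) * (P v + e) + (\<Sum>i\<in>I. b i k * (p i v + e)) + 1 / \<delta> (s k) * ((x k - z) \<bullet> v))
       \<longlonglongrightarrow> a * (P v + e) + (\<Sum>i\<in>I. \<mu> i * (p i v + e)) + a * ((z - z) \<bullet> v)"
      by (intro tendsto_intros a b x)
    then have "0 \<le> a * (P v + e) + (\<Sum>i\<in>I. \<mu> i * (p i v + e)) + a * ((z - z) \<bullet> v)"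
      by (rule tendsto_lowerbound[OF _ ev]) simp
    \<comment> \<open>The limit weights sum to 1, so the slack \<open>e\<close> granted to every
      slope adds up to exactly \<open>e\<close>.\<close>
    also have "\<dots> = a * P v + (\<Sum>i\<in>I. \<mu> i * p i v) + (a + (\<Sum>i\<in>I. \<mu> i)) * e"
      by (simp add: distrib_left distrib_right sum.distrib sum_distrib_right)
    also have "\<dots> = a * P v + (\<Sum>i\<in>I. \<mu> i * p i v) + e" by (simp add: a_def)
    finally show "0 \<le> a * P v + (\<Sum>i\<in>I. \<mu> i * p i v) + e" .
  qed
  have "\<forall>\<^sub>F k in sequentially. \<mu> i > 0 \<longrightarrow> h i (x k) > 0" if "i \<in> I" for i
  proof (cases "\<mu> i > 0")
    case True
    from order_tendstoD(1)[OF b[OF that] this] show ?thesis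
    proof eventually_elim
      case (elim k)
      then have "m i (s k) \<noteq> 0" by (auto simp: b_def)
      then show ?case by (auto simp: m_def x_def max_def split: if_splits)
    qed
  qed simp
  then have "\<forall>\<^sub>F k in sequentially. \<forall>i\<in>I. \<mu> i > 0 \<longrightarrow> h i (x k) > 0"
    by (intro eventually_ball_finite fin) auto
  \<comment> \<open>Positivity is needed at every index of the sequence, so the first
    \<open>N\<close> terms are dropped.\<close>
  then obtain N where N: "\<And>i k. k \<ge> N \<Longrightarrow> i \<in> I \<Longrightarrow> \<mu> i > 0 \<Longrightarrow> h i (x k) > 0"
    unfolding eventually_sequentially by blast
  show thesis
  proof (rule that[of a \<mu> "\<lambda>k. x (k + N)"])
    show "(\<lambda>k. x (k + N)) \<longlonglongrightarrow> z" using x by (rule LIMSEQ_ignore_initial_segment)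
  qed (use a_nonneg \<mu>_nonneg slope N ball in \<open>auto simp: a_def x_def\<close>)
qed

section \<open>Directional derivatives, tangential subdifferentials and Clarke regularity\<close>

text \<open>\<open>Lim\<close> is total, so it has to be tied to an actual finite limit before
  \<open>dir_deriv\<close> can be handled as a real number.\<close>

lemma tendsto_dir_deriv:
  assumes "tangentially_convex_at h z"
  shows "(diff_quot h z v \<longlongrightarrow> ereal (real_of_ereal (dir_deriv h z v))) (at_right 0)"
    and "dir_deriv h z v = ereal (real_of_ereal (dir_deriv h z v))"
proof -
  obtain l where l: "(diff_quot h z v \<longlongrightarrow> ereal l) (at_right 0)"
    using assms by (auto simp: tangentially_convex_at_def)
  then have "dir_deriv h z v = ereal l"
    unfolding dir_deriv_def by (intro tendsto_Lim) auto
  with l show "(diff_quot h z v \<longlongrightarrow> ereal (real_of_ereal (dir_deriv h z v))) (at_right 0)"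
    and "dir_deriv h z v = ereal (real_of_ereal (dir_deriv h z v))" by auto
qed

text \<open>Convexity is built into tangential convexity. Homogeneity comes from rescaling the step:
  the quotient along \<open>t *\<^sub>R v\<close> with step \<open>s\<close> is \<open>t\<close>
  times the quotient along \<open>v\<close> with step \<open>t * s\<close>.\<close>

lemma sublinear_dir_deriv:
  assumes h: "tangentially_convex_at h z"
  shows "sublinear (\<lambda>v. real_of_ereal (dir_deriv h z v))"
  unfolding sublinear_def
proof (intro conjI allI impI)
  show "convex_on UNIV (\<lambda>v. real_of_ereal (dir_deriv h z v))"
    using h by (simp add: tangentially_convex_at_def)
  fix t :: real and v assume t: "t > 0"
  have eq: "diff_quot h z (t *\<^sub>R v) s = ereal t * diff_quot h z v (t * s)" if "s > 0" for s
  proof -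
    have "ereal (1 / s) = ereal t * ereal (1 / (t * s))" using t by simp
    then show ?thesis using t that
      by (simp add: diff_quot_def divide_ereal_def inverse_eq_divide mult.commute mult.left_commute
          mult.assoc[symmetric])
  qed
  have "filterlim (\<lambda>s. t * s) (at_right 0) (at_right 0)"
    using filterlim_times_pos[OF filterlim_ident t, of "0::real" 0] by simp
  then have "((\<lambda>s. diff_quot h z v (t * s)) \<longlongrightarrow> ereal (real_of_ereal (dir_deriv h z v))) (at_right 0)"
    by (rule filterlim_compose[OF tendsto_dir_deriv(1)[OF h]])
  then have "((\<lambda>s. ereal t * diff_quot h z v (t * s))
      \<longlongrightarrow> ereal t * ereal (real_of_ereal (dir_deriv h z v))) (at_right 0)"
    by (intro tendsto_cmult_ereal) auto
  then have "(diff_quot h z (t *\<^sub>R v) \<longlongrightarrow> ereal t * ereal (real_of_ereal (dir_deriv h z v))) (at_right 0)"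
    by (rule Lim_transform_eventually)
      (auto simp: eq eventually_at_filter)
  with tendsto_dir_deriv(1)[OF h, of "t *\<^sub>R v"]
  have "ereal (real_of_ereal (dir_deriv h z (t *\<^sub>R v))) = ereal t * ereal (real_of_ereal (dir_deriv h z v))"
    by (intro tendsto_unique) auto
  then show "real_of_ereal (dir_deriv h z (t *\<^sub>R v)) = t * real_of_ereal (dir_deriv h z v)" by simp
qed

text \<open>This bridge carries the separation results for real sublinear functions over to
  tangential subgradients; it rests on the finiteness of all directional derivatives.\<close>

lemma tangential_subdiff_eq_dominated:
  assumes "tangentially_convex_at h z"
  shows "tangential_subdiff h z = dominated (\<lambda>v. real_of_ereal (dir_deriv h z v))"
  unfolding tangential_subdiff_def dominated_def
  by (subst tendsto_dir_deriv(2)[OF assms]) simp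

text \<open>Regularity makes the upper limit over moving base points equal to the directional
  derivative at \<open>z\<close>. Being strictly below \<open>P + \<epsilon>\<close>, it bounds all
  quotients with base point near \<open>z\<close> and small step.\<close>

lemma clarke_regular_strict_upper_slope:
  assumes reg: "clarke_regular h z" and h: "tangentially_convex_at h z"
  shows "strict_upper_slope (\<lambda>u. real_of_ereal (h u)) z (\<lambda>v. real_of_ereal (dir_deriv h z v))"
  unfolding strict_upper_slope_def
proof (intro allI impI)
  fix v and \<epsilon> :: real assume e: "\<epsilon> > 0"
  define P where "P = real_of_ereal (dir_deriv h z v)"
  obtain r where r: "r > 0" and fin: "\<And>u. u \<in> ball z r \<Longrightarrow> \<bar>h u\<bar> \<noteq> \<infinity>"
    using reg by (auto simp: clarke_regular_def locally_lipschitz_around_def)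
  have "clarke_dir_deriv h z v = ereal P" unfolding P_def
    using reg tendsto_dir_deriv(1)[OF h, of v]
    by (intro tendsto_unique[of "at_right 0" "diff_quot h z v"]) (auto simp: clarke_regular_def)
  then have "Limsup (nhds z \<times>\<^sub>F at_right 0) (\<lambda>(u, t). diff_quot h u v t) < ereal (P + \<epsilon>)"
    using e by (simp add: clarke_dir_deriv_def)
  \<comment> \<open>The product filter yields a range \<open>B\<close> of steps common to all base
    points in \<open>A\<close>. Only keeping \<open>u + t *\<^sub>R v\<close> where \<open>h\<close>
    is finite makes the final range depend on \<open>u\<close>.\<close>
  from Limsup_lessD[OF this] obtain A B
    where A: "eventually A (nhds z)" and B: "eventually B (at_right 0)"
      and AB: "\<And>u t. A u \<Longrightarrow> B t \<Longrightarrow> diff_quot h u v t < ereal (P + \<epsilon>)"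
    unfolding eventually_prod_filter by auto
  have "\<forall>\<^sub>F u in nhds z. u \<in> ball z r" using r by (intro eventually_nhds_in_open) auto
  with A show "\<forall>\<^sub>F u in nhds z. \<forall>\<^sub>F t in at_right 0.
      real_of_ereal (h (u + t *\<^sub>R v)) \<le> real_of_ereal (h u) + t * (P + \<epsilon>)"
  proof eventually_elim
    case (elim u)
    have "((\<lambda>t. u + t *\<^sub>R v) \<longlongrightarrow> u + 0 *\<^sub>R v) (at_right 0)" by (intro tendsto_intros)
    then have "\<forall>\<^sub>F t in at_right 0. u + t *\<^sub>R v \<in> ball z r"
      using elim(2) by (intro topological_tendstoD) auto
    moreover have "\<forall>\<^sub>F t in at_right (0::real). t > 0" by (rule eventually_at_right_less)
    ultimately show ?case using B
    proof eventually_elim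
      case (elim t)
      have "diff_quot h u v t < ereal (P + \<epsilon>)" using AB \<open>A u\<close> elim by blast
      moreover obtain x y where "h u = ereal x" "h (u + t *\<^sub>R v) = ereal y"
        using fin[OF \<open>u \<in> ball z r\<close>] fin[OF elim(1)] by auto
      ultimately show ?case using elim(2) by (simp add: diff_quot_def field_simps)
    qed
  qed
qed

section \<open>From Fritz John to KKT under quasinormality\<close>

text \<open>Speaking of all small radii rather than of one allows finitely many local properties to
  share a common closed ball.\<close>

lemma eventually_nhds_cball:
  fixes z :: "'a::metric_space"
  assumes "eventually P (nhds z)"
  shows "\<forall>\<^sub>F r in at_right 0. \<forall>u\<in>cball z r. P u"
proof -
  obtain d where "d > 0" "\<And>u. dist u z < d \<Longrightarrow> P u"
    using assms unfolding eventually_nhds_metric by blast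
  then show ?thesis
    unfolding eventually_at_right_field by (intro exI[of _ d]) (auto simp: dist_commute)
qed

lemma locally_lipschitz_around_cball:
  assumes "locally_lipschitz_around h z"
  shows "\<forall>\<^sub>F r in at_right 0. (\<forall>u\<in>cball z r. \<bar>h u\<bar> \<noteq> \<infinity>) \<and>
    continuous_on (cball z r) (\<lambda>u. real_of_ereal (h u))"
proof -
  obtain d L where d: "d > 0" and fin: "\<forall>u\<in>ball z d. \<bar>h u\<bar> \<noteq> \<infinity>"
    and L: "L-lipschitz_on (ball z d) (\<lambda>u. real_of_ereal (h u))"
    using assms unfolding locally_lipschitz_around_def by blast
  have "continuous_on (cball z r) (\<lambda>u. real_of_ereal (h u))" if "r < d" for r
    using lipschitz_on_continuous_on[OF L] by (rule continuous_on_subset) (use that in auto)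
  then show ?thesis
    unfolding eventually_at_right_field using d fin by (intro exI[of _ d]) auto
qed

text \<open>The Fritz John inequality becomes a relation between subgradients. Its weight
  \<open>a\<close> on the objective is nonzero by quasinormality, so it can be divided out. The
  hypothesis \<open>quasinormal\<close> is phrased for a single family of constraints, which keeps
  the bilevel structure out of the argument.\<close>

lemma enhanced_KKT:
  fixes F :: "'a::euclidean_space \<Rightarrow> ereal" and h :: "'i \<Rightarrow> 'a \<Rightarrow> ereal"
  assumes fin: "finite I"
    and F: "clarke_regular F z" "tangentially_convex_at F z"
    and h: "\<And>i. i \<in> I \<Longrightarrow> clarke_regular (h i) z" "\<And>i. i \<in> I \<Longrightarrow> tangentially_convex_at (h i) z"
    and feas: "\<And>i. i \<in> I \<Longrightarrow> h i z \<le> 0"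
    and min: "\<forall>\<^sub>F u in nhds z. (\<forall>i\<in>I. h i u \<le> 0) \<longrightarrow> F z \<le> F u"
    and quasinormal: "\<And>\<mu> \<xi> w. \<lbrakk>\<And>i. i \<in> I \<Longrightarrow> \<mu> i \<ge> 0; \<exists>i\<in>I. \<mu> i \<noteq> 0;
      \<And>i. i \<in> I \<Longrightarrow> \<xi> i \<in> tangential_subdiff (h i) z; (\<Sum>i\<in>I. \<mu> i *\<^sub>R \<xi> i) = 0;
      w \<longlonglongrightarrow> z; \<And>i k. i \<in> I \<Longrightarrow> \<mu> i > 0 \<Longrightarrow> h i (w k) > 0\<rbrakk> \<Longrightarrow> False"
  obtains \<mu> \<xi>F \<xi> where "\<And>i. i \<in> I \<Longrightarrow> \<mu> i \<ge> 0" "\<xi>F \<in> tangential_subdiff F z"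
    "\<And>i. i \<in> I \<Longrightarrow> \<xi> i \<in> tangential_subdiff (h i) z"
    "\<xi>F + (\<Sum>i\<in>I. \<mu> i *\<^sub>R \<xi> i) = 0" "\<And>i. i \<in> I \<Longrightarrow> \<mu> i > 0 \<Longrightarrow> h i z = 0"
proof -
  define P where "P = (\<lambda>v. real_of_ereal (dir_deriv F z v))"
  define p where "p = (\<lambda>i v. real_of_ereal (dir_deriv (h i) z v))"
  have lipF: "locally_lipschitz_around F z" and liph: "\<And>i. i \<in> I \<Longrightarrow> locally_lipschitz_around (h i) z"
    using F h by (auto simp: clarke_regular_def)
  have "\<forall>\<^sub>F r in at_right 0. \<forall>i\<in>I. (\<forall>u\<in>cball z r. \<bar>h i u\<bar> \<noteq> \<infinity>) \<and>
      continuous_on (cball z r) (\<lambda>u. real_of_ereal (h i u))"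
    by (intro eventually_ball_finite fin ballI locally_lipschitz_around_cball liph)
  with locally_lipschitz_around_cball[OF lipF] eventually_nhds_cball[OF min] eventually_at_right_less[of 0]
  have "\<forall>\<^sub>F r in at_right 0. r > 0 \<and> (\<forall>u\<in>cball z r. \<bar>F u\<bar> \<noteq> \<infinity>)
      \<and> continuous_on (cball z r) (\<lambda>u. real_of_ereal (F u))
      \<and> (\<forall>u\<in>cball z r. (\<forall>i\<in>I. h i u \<le> 0) \<longrightarrow> F z \<le> F u)
      \<and> (\<forall>i\<in>I. (\<forall>u\<in>cball z r. \<bar>h i u\<bar> \<noteq> \<infinity>) \<and>
      continuous_on (cball z r) (\<lambda>u. real_of_ereal (h i u)))"
    by eventually_elim auto
  from eventually_happens'[OF trivial_limit_at_right_real this] obtain r where r: "r > 0" and finF: "\<And>u. u \<in> cball z r \<Longrightarrow> \<bar>F u\<bar> \<noteq> \<infinity>"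
    and contF: "continuous_on (cball z r) (\<lambda>u. real_of_ereal (F u))"
    and minr: "\<And>u. u \<in> cball z r \<Longrightarrow> (\<And>i. i \<in> I \<Longrightarrow> h i u \<le> 0) \<Longrightarrow> F z \<le> F u"
    and finh: "\<And>i u. i \<in> I \<Longrightarrow> u \<in> cball z r \<Longrightarrow> \<bar>h i u\<bar> \<noteq> \<infinity>"
    and conth: "\<And>i. i \<in> I \<Longrightarrow> continuous_on (cball z r) (\<lambda>u. real_of_ereal (h i u))"
    by auto
  have zin: "z \<in> cball z r" using r by simp
  have hreal: "ereal (real_of_ereal (h i u)) = h i u" if "i \<in> I" "u \<in> cball z r" for i u
    using finh[OF that] by (simp add: ereal_real)
  have Freal: "ereal (real_of_ereal (F u)) = F u" if "u \<in> cball z r" for u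
    using finF[OF that] by (simp add: ereal_real)
  obtain a \<mu> w where a: "a \<ge> 0" and \<mu>: "\<And>i. i \<in> I \<Longrightarrow> \<mu> i \<ge> 0"
    and one: "a + (\<Sum>i\<in>I. \<mu> i) = 1"
    and slope: "\<And>v. 0 \<le> a * P v + (\<Sum>i\<in>I. \<mu> i * p i v)"
    and w: "w \<longlonglongrightarrow> z" "\<And>k::nat. w k \<in> cball z r"
    and active: "\<And>i k. i \<in> I \<Longrightarrow> \<mu> i > 0 \<Longrightarrow> real_of_ereal (h i (w k)) > 0"
  proof (rule enhanced_fritz_john[OF fin r contF conth])
    show "strict_upper_slope (\<lambda>u. real_of_ereal (F u)) z P"
      unfolding P_def by (rule clarke_regular_strict_upper_slope[OF F])
    show "strict_upper_slope (\<lambda>u. real_of_ereal (h i u)) z (p i)" if "i \<in> I" for i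
      unfolding p_def by (rule clarke_regular_strict_upper_slope[OF h[OF that]])
    show "real_of_ereal (h i z) \<le> 0" if "i \<in> I" for i
      using feas[OF that] by (simp add: real_of_ereal_le_0)
    show "real_of_ereal (F z) \<le> real_of_ereal (F u)"
      if u: "u \<in> cball z r" and le: "\<And>i. i \<in> I \<Longrightarrow> real_of_ereal (h i u) \<le> 0" for u
    proof -
      have "h i u \<le> 0" if "i \<in> I" for i
        using le[OF that] hreal[OF that u] by (metis zero_ereal_def ereal_less_eq(3))
      then have "F z \<le> F u" by (rule minr[OF u])
      then show ?thesis by (metis Freal u zin ereal_less_eq(3))
    qed
  qed (assumption | rule that)+
  \<comment> \<open>The extra index \<open>None\<close> stands for the objective with weight
    \<open>a\<close>, so that objective and constraints enter the separation result as one
    family.\<close>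
  define J where "J = insert None (Some ` I)"
  have sumJ: "(\<Sum>i\<in>J. f i) = f None + (\<Sum>i\<in>I. f (Some i))" for f :: "'i option \<Rightarrow> 'b::comm_monoid_add"
    using fin by (simp add: J_def sum.insert sum.reindex image_iff)
  obtain \<xi> where \<xi>: "\<And>i. i \<in> J \<Longrightarrow> \<xi> i \<in> dominated (case_option P p i)"
    "(\<Sum>i\<in>J. case_option a \<mu> i *\<^sub>R \<xi> i) = 0"
  proof (rule sublinear_combination_zero)
    show "finite J" using fin by (simp add: J_def)
    show "sublinear (case_option P p i)" if "i \<in> J" for i
    proof (cases i)
      case None
      then show ?thesis by (simp add: P_def sublinear_dir_deriv[OF F(2)])
    next
      case (Some j)
      then show ?thesis using that by (auto simp: J_def p_def sublinear_dir_deriv[OF h(2)])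
    qed
    show "0 \<le> (\<Sum>i\<in>J. case_option a \<mu> i * case_option P p i v)" for v
      using slope[of v] by (simp add: sumJ)
  qed (rule that)
  have \<xi>F: "\<xi> None \<in> tangential_subdiff F z"
    using \<xi>(1)[of None] F by (simp add: J_def tangential_subdiff_eq_dominated P_def)
  have \<xi>h: "\<xi> (Some i) \<in> tangential_subdiff (h i) z" if "i \<in> I" for i
    using \<xi>(1)[of "Some i"] h that by (simp add: J_def tangential_subdiff_eq_dominated p_def)
  have zero: "a *\<^sub>R \<xi> None + (\<Sum>i\<in>I. \<mu> i *\<^sub>R \<xi> (Some i)) = 0"
    using \<xi>(2) by (simp add: sumJ)
  have pos: "h i (w k) > 0" if "i \<in> I" "\<mu> i > 0" for i k
    using active[OF that, of k] hreal[OF that(1) w(2), of k] by (metis ereal_less(2))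
  have "a \<noteq> 0"
  proof
    assume "a = 0"
    \<comment> \<open>With \<open>a = 0\<close> the constraint multipliers sum to 1 and hence cannot
      all vanish, which is what quasinormality excludes.\<close>
    with one have "\<exists>i\<in>I. \<mu> i \<noteq> 0" by (metis add_0 sum.neutral zero_neq_one)
    with \<open>a = 0\<close> show False
      using quasinormal[of \<mu> "\<lambda>i. \<xi> (Some i)" w] \<mu> \<xi>h zero w(1) pos by auto
  qed
  then have a_pos: "a > 0" using a by simp
  show thesis
  proof (rule that[of "\<lambda>i. \<mu> i / a" "\<xi> None" "\<lambda>i. \<xi> (Some i)"])
    have "\<xi> None + (\<Sum>i\<in>I. (\<mu> i / a) *\<^sub>R \<xi> (Some i))
        = (1 / a) *\<^sub>R (a *\<^sub>R \<xi> None + (\<Sum>i\<in>I. \<mu> i *\<^sub>R \<xi> (Some i)))"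
      using a_pos by (simp add: scaleR_add_right scaleR_sum_right)
    then show "\<xi> None + (\<Sum>i\<in>I. (\<mu> i / a) *\<^sub>R \<xi> (Some i)) = 0" by (simp add: zero)
    show "h i z = 0" if i: "i \<in> I" and "\<mu> i / a > 0" for i
    proof -
      have "\<mu> i > 0" using that a_pos by (simp add: zero_less_divide_iff)
      \<comment> \<open>Complementarity: violation along \<open>w\<close> passes to the limit as
        \<open>0 \<le> h i z\<close>, and feasibility of \<open>z\<close> gives the reverse
        inequality.\<close>
      have "(\<lambda>k. real_of_ereal (h i (w k))) \<longlonglongrightarrow> real_of_ereal (h i z)"
        using continuous_on_tendsto_compose[OF conth[OF i] w(1) zin] w(2) by simp
      then have "0 \<le> real_of_ereal (h i z)"
        using active[OF i \<open>\<mu> i > 0\<close>] by (intro LIMSEQ_le_const) (auto intro: less_imp_le)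
      then have "0 \<le> h i z" using hreal[OF i zin] by (metis zero_ereal_def ereal_less_eq(3))
      then show ?thesis using feas[OF i] by simp
    qed
  qed (use \<xi>F \<xi>h \<mu> a_pos in auto)
qed

section \<open>The bilevel problem and its value-function reformulation\<close>

text \<open>A nonzero Frechet normal \<open>\<xi>\<close> is refuted by moving along
  \<open>\<xi>\<close> itself: the left side grows like \<open>t * (norm \<xi>)\<^sup>2\<close>,
  while the choice of \<open>norm \<xi> / 2\<close> as tolerance allows only half of that.\<close>

lemma limiting_normal_cone_UNIV: "limiting_normal_cone UNIV z = {0}"
proof -
  have frechet: "frechet_normal_cone UNIV w = {0}" for w :: 'a
  proof -
    have "\<xi> = 0" if "\<xi> \<in> frechet_normal_cone UNIV w" for \<xi>
    proof (rule ccontr)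
      assume "\<xi> \<noteq> 0"
      then have n: "norm \<xi> > 0" by simp
      then have "\<forall>\<^sub>F u in at w. \<xi> \<bullet> (u - w) \<le> (norm \<xi> / 2) * norm (u - w)"
        using that unfolding frechet_normal_cone_def by (auto dest!: spec[of _ "norm \<xi> / 2"])
      moreover have "filterlim (\<lambda>t. w + t *\<^sub>R \<xi>) (at w) (at_right 0)"
      proof (rule filterlim_atI)
        have "((\<lambda>t. w + t *\<^sub>R \<xi>) \<longlongrightarrow> w + 0 *\<^sub>R \<xi>) (at_right 0)" by (intro tendsto_intros)
        then show "((\<lambda>t. w + t *\<^sub>R \<xi>) \<longlongrightarrow> w) (at_right 0)" by simp
        show "\<forall>\<^sub>F t in at_right 0. w + t *\<^sub>R \<xi> \<noteq> w"
          using \<open>\<xi> \<noteq> 0\<close> by (auto simp: eventually_at_filter)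
      qed
      ultimately have "\<forall>\<^sub>F t in at_right 0. \<xi> \<bullet> (t *\<^sub>R \<xi>) \<le> (norm \<xi> / 2) * norm (t *\<^sub>R \<xi>)"
        unfolding filterlim_iff by fastforce
      with eventually_at_right_less[of 0]
      have "\<forall>\<^sub>F t in at_right (0::real). False"
      proof eventually_elim
        case (elim t)
        then have "t * (norm \<xi>)\<^sup>2 \<le> t * (norm \<xi>)\<^sup>2 / 2"
          by (simp add: power2_norm_eq_inner[symmetric] power2_eq_square algebra_simps)
        moreover have "t * (norm \<xi>)\<^sup>2 > 0" using elim(1) n by simp
        ultimately show ?case by linarith
      qed
      then show False by simp
    qed
    moreover have "0 \<in> frechet_normal_cone UNIV w" by (simp add: frechet_normal_cone_def)
    ultimately show ?thesis by blast
  qed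
  show ?thesis
  proof (intro set_eqI iffI)
    fix \<xi> assume "\<xi> \<in> limiting_normal_cone UNIV z"
    then obtain \<zeta> where "\<zeta> \<longlonglongrightarrow> \<xi>" "\<And>k::nat. \<zeta> k = 0"
      by (auto simp: limiting_normal_cone_def frechet)
    then have "(\<lambda>k::nat. 0) \<longlonglongrightarrow> \<xi>" by (metis (mono_tags) tendsto_cong always_eventually)
    then show "\<xi> \<in> {0}" by (simp add: LIMSEQ_const_iff)
  next
    fix \<xi> :: 'a assume "\<xi> \<in> {0}"
    moreover have "(\<lambda>_::nat. z) \<longlonglongrightarrow> z" "(\<lambda>_::nat. 0::'a) \<longlonglongrightarrow> 0" by auto
    ultimately show "\<xi> \<in> limiting_normal_cone UNIV z"
      unfolding limiting_normal_cone_def frechet by fast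
  qed
qed

text \<open>For \<open>y\<close> feasible in the lower level, a nonpositive gap says that
  \<open>f (x, y)\<close> is a lower bound of the values whose infimum is
  \<open>value_function f g q x\<close>. The subtraction may be undone also for infinite infima
  because \<open>f (x, y)\<close> is finite.\<close>

lemma bilevel_feasible_eq_reformulation_feasible:
  "bilevel_feasible f g q G p = reformulation_feasible f g q G p"
proof -
  have "y \<in> lower_solutions f g q x \<longleftrightarrow> value_gap f g q (x, y) \<le> 0 \<and> (\<forall>i\<in>{1..q}. g i (x, y) \<le> 0)"
    for x and y
  proof (cases "\<forall>i\<in>{1..q}. g i (x, y) \<le> 0")
    case True
    have "value_gap f g q (x, y) \<le> 0 \<longleftrightarrow> ereal (f (x, y)) \<le> value_function f g q x"
      unfolding value_gap_def by (cases "value_function f g q x") auto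
    also have "\<dots> \<longleftrightarrow> (\<forall>y'\<in>lower_feasible g q x. f (x, y) \<le> f (x, y'))"
      by (auto simp: value_function_def le_INF_iff)
    finally show ?thesis using True by (auto simp: lower_solutions_def lower_feasible_def)
  qed (auto simp: lower_solutions_def lower_feasible_def)
  then show ?thesis unfolding bilevel_feasible_def reformulation_feasible_def by auto
qed

theorem theorem14:
  fixes F f :: "(real^'n) \<times> (real^'m) \<Rightarrow> real"
    and G g :: "nat \<Rightarrow> (real^'n) \<times> (real^'m) \<Rightarrow> real"
    and p q :: nat
    and xbar :: "real^'n" and ybar :: "real^'m"
  assumes local_min: "bilevel_local_minimizer F f g q G p (xbar, ybar)"
    and tangent_cone_convex:
      "convex (contingent_cone (reformulation_feasible f g q G p) (xbar, ybar))"
    and lip: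
      "locally_lipschitz_around (\<lambda>z. ereal (F z)) (xbar, ybar)"
      "locally_lipschitz_around (value_gap f g q) (xbar, ybar)"
      "\<forall>i\<in>{1..q}. locally_lipschitz_around (\<lambda>z. ereal (g i z)) (xbar, ybar)"
      "\<forall>j\<in>{1..p}. locally_lipschitz_around (\<lambda>z. ereal (G j z)) (xbar, ybar)"
      "locally_lipschitz_around (value_function f g q) xbar"
    and tconv:
      "tangentially_convex_around (\<lambda>z. ereal (F z)) (xbar, ybar)"
      "tangentially_convex_around (value_gap f g q) (xbar, ybar)"
      "\<forall>i\<in>{1..q}. tangentially_convex_around (\<lambda>z. ereal (g i z)) (xbar, ybar)"
      "\<forall>j\<in>{1..p}. tangentially_convex_around (\<lambda>z. ereal (G j z)) (xbar, ybar)"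
      "tangentially_convex_around (value_function f g q) xbar"
    and regular:
      "clarke_regular (\<lambda>z. ereal (F z)) (xbar, ybar)"
      "clarke_regular (value_gap f g q) (xbar, ybar)"
      "\<forall>i\<in>{1..q}. clarke_regular (\<lambda>z. ereal (g i z)) (xbar, ybar)"
      "\<forall>j\<in>{1..p}. clarke_regular (\<lambda>z. ereal (G j z)) (xbar, ybar)"
    and normal_cone_osc:
      "outer_semicontinuous_at
         (limiting_normal_cone (UNIV :: ((real^'n) \<times> (real^'m)) set)) (xbar, ybar)"
    and quasinormal: "bilevel_T_quasinormal f g q G p (xbar, ybar)"
  shows "limiting_normal_cone UNIV (xbar, ybar) = {0} \<and>
    (\<exists>(\<mu>::real) (\<alpha>::nat \<Rightarrow> real) (\<beta>::nat \<Rightarrow> real) \<xi>F \<xi>H \<xi> \<zeta> \<eta>.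
       \<mu> \<ge> 0 \<and> (\<forall>i\<in>{1..q}. \<alpha> i \<ge> 0) \<and> (\<forall>j\<in>{1..p}. \<beta> j \<ge> 0) \<and>
       \<xi>F \<in> tangential_subdiff (\<lambda>z. ereal (F z)) (xbar, ybar) \<and>
       \<xi>H \<in> tangential_subdiff (value_gap f g q) (xbar, ybar) \<and>
       (\<forall>i\<in>{1..q}. \<xi> i \<in> tangential_subdiff (\<lambda>z. ereal (g i z)) (xbar, ybar)) \<and>
       (\<forall>j\<in>{1..p}. \<zeta> j \<in> tangential_subdiff (\<lambda>z. ereal (G j z)) (xbar, ybar)) \<and>
       \<eta> \<in> limiting_normal_cone UNIV (xbar, ybar) \<and>
       0 = \<xi>F + \<mu> *\<^sub>R \<xi>H + (\<Sum>i\<in>{1..q}. \<alpha> i *\<^sub>R \<xi> i) + (\<Sum>j\<in>{1..p}. \<beta> j *\<^sub>R \<zeta> j) + \<eta> \<and>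
       ereal \<mu> * value_gap f g q (xbar, ybar) = 0 \<and>
       (\<forall>i\<in>{1..q}. \<alpha> i * g i (xbar, ybar) = 0) \<and>
       (\<forall>j\<in>{1..p}. \<beta> j * G j (xbar, ybar) = 0))"
proof -
  define z where "z = (xbar, ybar)"
  define H where "H = value_gap f g q"
  \<comment> \<open>A disjoint sum merges the three kinds of constraints: \<open>Inl ()\<close> is
    the value gap, \<open>Inr (Inl i)\<close> the lower-level and \<open>Inr (Inr j)\<close> the
    upper-level constraints.\<close>
  define I :: "(unit + (nat + nat)) set" where "I = {()} <+> ({1..q} <+> {1..p})"
  define h :: "unit + (nat + nat) \<Rightarrow> _" where "h = case_sum (\<lambda>_. H) (case_sum (\<lambda>i u. ereal (g i u)) (\<lambda>j u. ereal (G j u)))"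
  have fin: "finite I" by (simp add: I_def)
  have ball_I_iff: "(\<forall>i\<in>I. Q i) \<longleftrightarrow> Q (Inl ()) \<and> (\<forall>i\<in>{1..q}. Q (Inr (Inl i))) \<and> (\<forall>j\<in>{1..p}. Q (Inr (Inr j)))"
    for Q by (auto simp: I_def)
  have sumI: "(\<Sum>i\<in>I. s i) = s (Inl ()) + (\<Sum>i\<in>{1..q}. s (Inr (Inl i))) + (\<Sum>j\<in>{1..p}. s (Inr (Inr j)))"
    for s :: "_ \<Rightarrow> 'c::comm_monoid_add"
    by (simp add: I_def sum.Plus add.assoc)
  have feasible_iff: "u \<in> reformulation_feasible f g q G p \<longleftrightarrow> (\<forall>i\<in>I. h i u \<le> 0)" for u
    unfolding ball_I_iff by (simp add: reformulation_feasible_def h_def H_def)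
  have tc: "tangentially_convex_at h' z" if "tangentially_convex_around h' z" for h' :: "(real^'n) \<times> (real^'m) \<Rightarrow> ereal"
    using that eventually_nhds_x_imp_x by (auto simp: tangentially_convex_around_def)
  have regh: "\<forall>i\<in>I. clarke_regular (h i) z"
    unfolding ball_I_iff using regular by (simp add: h_def H_def z_def)
  have tch: "\<forall>i\<in>I. tangentially_convex_at (h i) z"
    unfolding ball_I_iff using tconv by (simp add: h_def H_def z_def[symmetric] tc)
  obtain \<mu> \<xi>F \<xi> where \<mu>: "\<forall>i\<in>I. \<mu> i \<ge> 0" and \<xi>F: "\<xi>F \<in> tangential_subdiff (\<lambda>u. ereal (F u)) z"
    and \<xi>: "\<forall>i\<in>I. \<xi> i \<in> tangential_subdiff (h i) z"
    and zero: "\<xi>F + (\<Sum>i\<in>I. \<mu> i *\<^sub>R \<xi> i) = 0" and compl: "\<forall>i\<in>I. \<mu> i > 0 \<longrightarrow> h i z = 0"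
  proof (rule enhanced_KKT[OF fin, of "\<lambda>u. ereal (F u)" z h])
    show "clarke_regular (\<lambda>u. ereal (F u)) z" using regular by (simp add: z_def)
    show "tangentially_convex_at (\<lambda>u. ereal (F u)) z" using tconv by (simp add: z_def[symmetric] tc)
    have "z \<in> reformulation_feasible f g q G p" using quasinormal
      by (simp add: bilevel_T_quasinormal_def z_def)
    then show "h i z \<le> 0" if "i \<in> I" for i using that by (simp add: feasible_iff)
    show "\<forall>\<^sub>F u in nhds z. (\<forall>i\<in>I. h i u \<le> 0) \<longrightarrow> ereal (F z) \<le> ereal (F u)"
      using local_min
      by (simp add: bilevel_local_minimizer_def bilevel_feasible_eq_reformulation_feasible
          feasible_iff z_def[symmetric])
    \<comment> \<open>Multipliers excluded by the abstract condition are split along the sum type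
      into the data forbidden by \<open>bilevel_T_quasinormal\<close>.\<close>
    fix \<mu> \<xi> and w :: "nat \<Rightarrow> _"
    assume nonneg: "\<And>i. i \<in> I \<Longrightarrow> \<mu> i \<ge> 0" and nz: "\<exists>i\<in>I. \<mu> i \<noteq> 0"
      and \<xi>: "\<And>i. i \<in> I \<Longrightarrow> \<xi> i \<in> tangential_subdiff (h i) z"
      and zero: "(\<Sum>i\<in>I. \<mu> i *\<^sub>R \<xi> i) = 0" and w: "w \<longlonglongrightarrow> z"
      and pos: "\<And>i k. i \<in> I \<Longrightarrow> \<mu> i > 0 \<Longrightarrow> h i (w k) > 0"
    define m \<alpha> \<beta> where "m = \<mu> (Inl ())" and "\<alpha> = (\<lambda>i. \<mu> (Inr (Inl i)))" and "\<beta> = (\<lambda>j. \<mu> (Inr (Inr j)))"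
    have sgn: "m \<ge> 0" "\<forall>i\<in>{1..q}. \<alpha> i \<ge> 0" "\<forall>j\<in>{1..p}. \<beta> j \<ge> 0"
      using nonneg unfolding m_def \<alpha>_def \<beta>_def by (auto simp: I_def)
    have nz': "m \<noteq> 0 \<or> (\<exists>i\<in>{1..q}. \<alpha> i \<noteq> 0) \<or> (\<exists>j\<in>{1..p}. \<beta> j \<noteq> 0)"
      using nz unfolding m_def \<alpha>_def \<beta>_def by (auto simp: I_def)
    have sub: "\<xi> (Inl ()) \<in> tangential_subdiff H z"
      "\<forall>i\<in>{1..q}. \<xi> (Inr (Inl i)) \<in> tangential_subdiff (\<lambda>u. ereal (g i u)) z"
      "\<forall>j\<in>{1..p}. \<xi> (Inr (Inr j)) \<in> tangential_subdiff (\<lambda>u. ereal (G j u)) z"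
      using \<xi>[of "Inl ()"] \<xi>[of "Inr (Inl _)"] \<xi>[of "Inr (Inr _)"] by (auto simp: I_def h_def)
    \<comment> \<open>The trailing 0 is the summand from the normal cone of the whole space.\<close>
    have "m *\<^sub>R \<xi> (Inl ()) + (\<Sum>i\<in>{1..q}. \<alpha> i *\<^sub>R \<xi> (Inr (Inl i))) + (\<Sum>j\<in>{1..p}. \<beta> j *\<^sub>R \<xi> (Inr (Inr j))) + 0
      \<in> (\<lambda>\<xi>. m *\<^sub>R \<xi>) ` tangential_subdiff H z
              + (\<Sum>i\<in>{1..q}. (\<lambda>\<xi>. \<alpha> i *\<^sub>R \<xi>) ` tangential_subdiff (\<lambda>u. ereal (g i u)) z)
              + (\<Sum>j\<in>{1..p}. (\<lambda>\<xi>. \<beta> j *\<^sub>R \<xi>) ` tangential_subdiff (\<lambda>u. ereal (G j u)) z)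
              + limiting_normal_cone UNIV z"
      using sub by (intro set_plus_intro) (auto simp: set_sum_alt limiting_normal_cone_UNIV)
    then have mem: "0 \<in> (\<lambda>\<xi>. m *\<^sub>R \<xi>) ` tangential_subdiff H z
              + (\<Sum>i\<in>{1..q}. (\<lambda>\<xi>. \<alpha> i *\<^sub>R \<xi>) ` tangential_subdiff (\<lambda>u. ereal (g i u)) z)
              + (\<Sum>j\<in>{1..p}. (\<lambda>\<xi>. \<beta> j *\<^sub>R \<xi>) ` tangential_subdiff (\<lambda>u. ereal (G j u)) z)
              + limiting_normal_cone UNIV z"
      using zero by (simp add: sumI m_def \<alpha>_def \<beta>_def)
    \<comment> \<open>Some multiplier is positive, and its constraint is violated at every
      \<open>w k\<close>.\<close>
    have "w k \<notin> reformulation_feasible f g q G p" for k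
    proof -
      obtain i where i: "i \<in> I" "\<mu> i > 0" using nz nonneg by force
      then show ?thesis using pos[OF i, of k] by (auto simp: feasible_iff not_le)
    qed
    moreover have "ereal m * H (w k) > 0" if "m > 0" for k
      using pos[of "Inl ()" k] that by (auto simp: m_def h_def I_def ereal_zero_less_0_iff)
    moreover have "\<alpha> i * g i (w k) > 0" if "i \<in> {1..q}" "\<alpha> i > 0" for i k
    proof -
      have "Inr (Inl i) \<in> I" using that by (auto simp: I_def)
      from pos[OF this, of k] show ?thesis using that by (simp add: \<alpha>_def h_def)
    qed
    moreover have "\<beta> j * G j (w k) > 0" if "j \<in> {1..p}" "\<beta> j > 0" for j k
    proof -
      have "Inr (Inr j) \<in> I" using that by (auto simp: I_def)
      from pos[OF this, of k] show ?thesis using that by (simp add: \<beta>_def h_def)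
    qed
    ultimately show False
      using quasinormal sgn nz' mem w
      unfolding bilevel_T_quasinormal_def z_def[symmetric] H_def[symmetric] by blast
  qed (use regh tch in blast)+
  \<comment> \<open>A zero multiplier annihilates every extended real, including infinite ones; a
    positive one comes with \<open>h i z = 0\<close>.\<close>
  have compl': "ereal (\<mu> i) * h i z = 0" if "i \<in> I" for i
    using compl \<mu> that by (cases "\<mu> i = 0") force+
  show ?thesis
    unfolding z_def[symmetric] H_def[symmetric]
  proof (intro conjI exI)
    \<comment> \<open>Proving the equation first instantiates all existential witnesses, with
      \<open>\<eta>\<close> taken as 0.\<close>
    show "0 = \<xi>F + \<mu> (Inl ()) *\<^sub>R \<xi> (Inl ()) + (\<Sum>i\<in>{1..q}. \<mu> (Inr (Inl i)) *\<^sub>R \<xi> (Inr (Inl i)))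
        + (\<Sum>j\<in>{1..p}. \<mu> (Inr (Inr j)) *\<^sub>R \<xi> (Inr (Inr j))) + 0"
      using zero by (simp add: sumI add.assoc)
    show "\<forall>i\<in>{1..q}. \<mu> (Inr (Inl i)) * g i z = 0" "\<forall>j\<in>{1..p}. \<mu> (Inr (Inr j)) * G j z = 0"
      using compl'[of "Inr (Inl _)"] compl'[of "Inr (Inr _)"] by (auto simp: I_def h_def)
    show "ereal (\<mu> (Inl ())) * H z = 0"
      using compl'[of "Inl ()"] by (auto simp: I_def h_def)
  qed (use \<mu> \<xi> \<xi>F in \<open>auto simp: ball_I_iff h_def limiting_normal_cone_UNIV\<close>)
qed

end
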